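(* There exist a finite alphabet $\Sigma$, a language $L\subseteq\Sigma^*$, and an open edit-based violation measure $m$ for $L$ such that the tightest contractible approximation $m^*$ of $m$ cannot be expressed as a proper open edit-based violation measure on any language; that is, there is no language $L'\subseteq\Sigma^*$ and weights $\alpha',\beta',\gamma',\delta'$ such that the open edit-based violation measure $m'$ for $L'$ with these weights satisfies $m'(w)=0\iff w\in P(L')$ for all $w\in\Sigma^*$ and $m'=m^*$.
   Context: $P(L)=\{w\mid\exists u\; wu\in L\}$ is the prefix-closure of $L$. Edit operations on words: substitution of a letter, insertion of a letter, deletion of a letter, transposition of two adjacent letters. Given non-negative weights $\alpha,\beta,\gamma,\delta$, the open edit-based violation measure for $L$ is $m(w)=\min(\alpha n_s+\beta n_i+\gamma n_d+\delta n_t)$ over all edit sequences transforming $w$ into an element of $P(L)$, with $n_s,n_i,n_d,n_t$ the numbers of substitutions, insertions, deletions, transpositions. A function $f$ from words to non-negative reals is contractible if $f(wa)\ge f(w)$ for every word $w$ and letter $a$. A function $m_1$ is an approximation of $m$ if $m_1(w)\le m(w)$ for all words $w$. The tightest contractible approximation $m^*$ of $m$ is the contractible approximation of $m$ such that every contractible approximation $k$ of $m$ satisfies $k\le m^*$ pointwise (it is given by $m^*(w)=\inf_{u}m(wu)$). *)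

theory Defs
  imports Complex_Main
begin

definition prefix_closure :: "'a list set \<Rightarrow> 'a list set" where
  "prefix_closure L = {w. \<exists>u. w @ u \<in> L}"

text \<open>
  \<open>edits A w ns ni nd nt v\<close>: some finite edit sequence over the alphabet \<open>A\<close> transforms \<open>w\<close> into
  \<open>v\<close> using exactly \<open>ns\<close> substitutions, \<open>ni\<close> insertions, \<open>nd\<close> deletions and \<open>nt\<close> transpositions of
  adjacent letters.  Later edits may act on letters already touched by earlier ones.
\<close>

inductive edits :: "'a set \<Rightarrow> 'a list \<Rightarrow> nat \<Rightarrow> nat \<Rightarrow> nat \<Rightarrow> nat \<Rightarrow> 'a list \<Rightarrow> bool"
  for A :: "'a set" and w :: "'a list" where
  refl: "edits A w 0 0 0 0 w"
| subst: "edits A w ns ni nd nt (x @ a # y) \<Longrightarrow> b \<in> A \<Longrightarrow> edits A w (Suc ns) ni nd nt (x @ b # y)"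
| ins: "edits A w ns ni nd nt (x @ y) \<Longrightarrow> b \<in> A \<Longrightarrow> edits A w ns (Suc ni) nd nt (x @ b # y)"
| del: "edits A w ns ni nd nt (x @ a # y) \<Longrightarrow> edits A w ns ni (Suc nd) nt (x @ y)"
| transp: "edits A w ns ni nd nt (x @ a # b # y) \<Longrightarrow> edits A w ns ni nd (Suc nt) (x @ b # a # y)"

definition edit_costs ::
  "'a set \<Rightarrow> 'a list set \<Rightarrow> real \<Rightarrow> real \<Rightarrow> real \<Rightarrow> real \<Rightarrow> 'a list \<Rightarrow> real set" where
  "edit_costs A L \<alpha> \<beta> \<gamma> \<delta> w =
     {\<alpha> * real ns + \<beta> * real ni + \<gamma> * real nd + \<delta> * real nt | ns ni nd nt v.
        v \<in> prefix_closure L \<and> edits A w ns ni nd nt v}"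

text \<open>
  Violation measures are functions on the words over \<open>A\<close>; their values outside \<open>lists A\<close> are
  irrelevant.  The measure is the minimum of the edit costs, stated as an attained lower bound, so
  the empty language (for which there is no cost to minimise over) has no measure.
\<close>

definition open_edit_measure ::
  "'a set \<Rightarrow> 'a list set \<Rightarrow> real \<Rightarrow> real \<Rightarrow> real \<Rightarrow> real \<Rightarrow> ('a list \<Rightarrow> real) \<Rightarrow> bool" where
  "open_edit_measure A L \<alpha> \<beta> \<gamma> \<delta> m \<longleftrightarrow>
     0 \<le> \<alpha> \<and> 0 \<le> \<beta> \<and> 0 \<le> \<gamma> \<and> 0 \<le> \<delta> \<and>
     (\<forall>w \<in> lists A. m w \<in> edit_costs A L \<alpha> \<beta> \<gamma> \<delta> w \<and>
        (\<forall>c \<in> edit_costs A L \<alpha> \<beta> \<gamma> \<delta> w. m w \<le> c))"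

definition proper :: "'a set \<Rightarrow> 'a list set \<Rightarrow> ('a list \<Rightarrow> real) \<Rightarrow> bool" where
  "proper A L m \<longleftrightarrow> (\<forall>w \<in> lists A. m w = 0 \<longleftrightarrow> w \<in> prefix_closure L)"

definition contractible :: "'a set \<Rightarrow> ('a list \<Rightarrow> real) \<Rightarrow> bool" where
  "contractible A f \<longleftrightarrow> (\<forall>w \<in> lists A. \<forall>a \<in> A. f w \<le> f (w @ [a]))"

definition contractible_approximation ::
  "'a set \<Rightarrow> ('a list \<Rightarrow> real) \<Rightarrow> ('a list \<Rightarrow> real) \<Rightarrow> bool" where
  "contractible_approximation A m k \<longleftrightarrow>
     (\<forall>w \<in> lists A. 0 \<le> k w) \<and> contractible A k \<and> (\<forall>w \<in> lists A. k w \<le> m w)"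

definition tightest_contractible_approximation ::
  "'a set \<Rightarrow> ('a list \<Rightarrow> real) \<Rightarrow> ('a list \<Rightarrow> real) \<Rightarrow> bool" where
  "tightest_contractible_approximation A m ms \<longleftrightarrow>
     contractible_approximation A m ms \<and>
     (\<forall>k. contractible_approximation A m k \<longrightarrow> (\<forall>w \<in> lists A. k w \<le> ms w))"

end

(* Take L = {abb}, with unit transpositions and all other edits of weight 2.  The word b becomes a
   prefix of abb once an a is appended and the two letters are transposed, so m*(b) = 1.
   In a proper measure m' = m* the word b itself must be edited, and transpositions do not change
   it; so a substitution, an insertion or a deletion has weight at most 1.  But one substitution
   or one deletion repairs aa, and one insertion repairs bb, while m*(aa) and m*(bb) are at least 2. *)

theory Submission imports Defs "HOL-Library.Multiset" begin

text \<open>Makes cost sets nonempty: the empty word is a prefix of every word, so deleting all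
  letters reaches the prefix closure of any nonempty language.\<close>

lemma edits_delete_all:
  assumes "edits A w ns ni nd nt v"
  shows "edits A w ns ni (nd + length v) nt []"
  using assms
proof (induction v arbitrary: nd rule: list.induct)
  case (Cons a v)
  have "edits A w ns ni (Suc nd) nt ([] @ v)"
    by (rule edits.del[where a = a]) (simp add: Cons.prems)
  then have "edits A w ns ni (Suc nd + length v) nt []"
    by (intro Cons.IH) simp
  then show ?case by simp
qed simp

lemma edits_transp_only_mset:
  assumes "edits A w 0 0 0 nt v"
  shows "mset v = mset w"
proof -
  \<comment> \<open>The zero counts become variables with equations so that rule induction applies;
    rules that raise one of them contradict the equations, and a transposition keeps the
    multiset.\<close>
  have "ns = 0 \<Longrightarrow> ni = 0 \<Longrightarrow> nd = 0 \<Longrightarrow> mset v = mset w" if "edits A w ns ni nd nt v" for ns ni nd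
    using that by induction (auto simp: add_mset_commute)
  with assms show ?thesis by blast
qed

lemma edits_none:
  assumes "edits A w 0 0 0 0 v"
  shows "v = w"
  using assms by (cases rule: edits.cases) simp

text \<open>The last edit must be the transposition, and the sequence before it has all counts zero,
  so it starts from \<open>w\<close> itself.\<close>

lemma edits_one_transp:
  assumes "edits A w 0 0 0 1 v"
  shows "\<exists>x a b y. w = x @ a # b # y \<and> v = x @ b # a # y"
  using assms
proof (cases rule: edits.cases)
  case (transp nt x a b y)
  then have "x @ a # b # y = w"
    by (intro edits_none) simp
  then have "w = x @ a # b # y \<and> v = x @ b # a # y"
    using transp(2) by (intro conjI) (rule sym)
  then show ?thesis by (intro exI)
qed simp_all

text \<open>With natural weights all costs are natural numbers, so a least one exists by
  well-ordering.\<close>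

lemma open_edit_measure_exists:
  fixes \<alpha> \<beta> \<gamma> \<delta> :: nat
  assumes "L \<noteq> {}"
  obtains m where "open_edit_measure A L (real \<alpha>) (real \<beta>) (real \<gamma>) (real \<delta>) m"
proof -
  define P where "P = (\<lambda>w n. real n \<in> edit_costs A L \<alpha> \<beta> \<gamma> \<delta> w)"
  have nat_cost: "\<exists>n. c = real n" if "c \<in> edit_costs A L \<alpha> \<beta> \<gamma> \<delta> w" for c w
  proof -
    from that obtain ns ni nd nt where "c = \<alpha> * real ns + \<beta> * real ni + \<gamma> * real nd + \<delta> * real nt"
      unfolding edit_costs_def by blast
    then have "c = real (\<alpha> * ns + \<beta> * ni + \<gamma> * nd + \<delta> * nt)" by simp
    then show ?thesis by blast
  qed
  have ex: "\<exists>n. P w n" for w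
  proof -
    have "[] \<in> prefix_closure L"
      using assms by (auto simp: prefix_closure_def)
    moreover have "edits A w 0 0 (length w) 0 []"
      using edits_delete_all[OF edits.refl] by fastforce
    ultimately have "\<alpha> * real 0 + \<beta> * real 0 + \<gamma> * real (length w) + \<delta> * real 0
        \<in> edit_costs A L \<alpha> \<beta> \<gamma> \<delta> w"
      unfolding edit_costs_def by blast
    then show ?thesis
      using nat_cost unfolding P_def by metis
  qed
  have "open_edit_measure A L \<alpha> \<beta> \<gamma> \<delta> (\<lambda>w. real (LEAST n. P w n))"
    unfolding open_edit_measure_def
  proof (intro conjI ballI)
    fix w
    show "real (LEAST n. P w n) \<in> edit_costs A L \<alpha> \<beta> \<gamma> \<delta> w"
      using LeastI_ex[OF ex[of w]] by (simp add: P_def)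
    fix c assume c: "c \<in> edit_costs A L \<alpha> \<beta> \<gamma> \<delta> w"
    then obtain n where "c = real n"
      using nat_cost by blast
    with c show "real (LEAST n. P w n) \<le> c"
      by (simp add: P_def Least_le)
  qed simp_all
  then show thesis by (rule that)
qed

lemma contractible_append:
  assumes "contractible A f" "w \<in> lists A" "u \<in> lists A"
  shows "f w \<le> f (w @ u)"
  using assms(3)
\<comment> \<open>Contractibility compares a word with its extension by one last letter, hence
  induction from the right.\<close>
proof (induction u rule: rev_induct)
  case (snoc a u)
  then have "f (w @ u) \<le> f ((w @ u) @ [a])"
    using snoc.prems assms(1,2) by (simp add: contractible_def del: append_assoc)
  with snoc show ?case by fastforce
qed simp

text \<open>Extensions of \<open>w @ [a]\<close> are among those of \<open>w\<close>, so the infimum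
  grows with the word; any contractible approximation \<open>k\<close> has
  \<open>k w \<le> k (w @ u) \<le> m (w @ u)\<close>. Nonnegativity bounds the sets below, as the
  real infimum requires.\<close>

lemma INF_append_tightest:
  assumes nonneg: "\<And>w. w \<in> lists A \<Longrightarrow> 0 \<le> m w"
  shows "tightest_contractible_approximation A m (\<lambda>w. INF u\<in>lists A. m (w @ u))"
proof -
  have bdd: "bdd_below ((\<lambda>u. m (w @ u)) ` lists A)" if "w \<in> lists A" for w
    using that nonneg by (intro bdd_belowI2[of _ 0]) simp
  have ne: "lists A \<noteq> {}" by blast
  show ?thesis
    unfolding tightest_contractible_approximation_def contractible_approximation_def
  proof (intro conjI allI impI ballI)
    fix w assume w: "w \<in> lists A"
    show "0 \<le> (INF u\<in>lists A. m (w @ u))"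
      using w nonneg by (intro cINF_greatest ne) simp
    show "(INF u\<in>lists A. m (w @ u)) \<le> m w"
      using cINF_lower[OF bdd[OF w], of "[]"] by simp
    fix k assume k: "(\<forall>w\<in>lists A. 0 \<le> k w) \<and> contractible A k \<and> (\<forall>w\<in>lists A. k w \<le> m w)"
    show "k w \<le> (INF u\<in>lists A. m (w @ u))"
    proof (intro cINF_greatest ne)
      fix u assume u: "u \<in> lists A"
      have "k w \<le> k (w @ u)"
        using k w u by (blast intro: contractible_append)
      also have "\<dots> \<le> m (w @ u)"
        using k w u by simp
      finally show "k w \<le> m (w @ u)" .
    qed
  next
    show "contractible A (\<lambda>w. INF u\<in>lists A. m (w @ u))"
      unfolding contractible_def
    proof (intro ballI cINF_greatest ne)
      fix w a u assume "w \<in> lists A" "a \<in> A" "u \<in> lists A"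
      then show "(INF u\<in>lists A. m (w @ u)) \<le> m ((w @ [a]) @ u)"
        using cINF_lower[OF bdd, of w "a # u"] by simp
    qed
  qed
qed

text \<open>Turns an explicit edit sequence into an upper bound on the measure or, where the measure
  is known to be large, into a lower bound on a weight.\<close>

lemma open_edit_measure_le:
  assumes "open_edit_measure A L \<alpha> \<beta> \<gamma> \<delta> m" "w \<in> lists A"
    "edits A w ns ni nd nt v" "v \<in> prefix_closure L"
  shows "m w \<le> \<alpha> * real ns + \<beta> * real ni + \<gamma> * real nd + \<delta> * real nt"
proof -
  have "\<alpha> * real ns + \<beta> * real ni + \<gamma> * real nd + \<delta> * real nt \<in> edit_costs A L \<alpha> \<beta> \<gamma> \<delta> w"
    using assms(3,4) unfolding edit_costs_def by blast
  then show ?thesis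
    using assms(1,2) unfolding open_edit_measure_def by blast
qed

lemma open_edit_measure_attained:
  assumes "open_edit_measure A L \<alpha> \<beta> \<gamma> \<delta> m" "w \<in> lists A"
  obtains ns ni nd nt v where "edits A w ns ni nd nt v" "v \<in> prefix_closure L"
    "m w = \<alpha> * real ns + \<beta> * real ni + \<gamma> * real nd + \<delta> * real nt"
proof -
  have "m w \<in> edit_costs A L \<alpha> \<beta> \<gamma> \<delta> w"
    using assms unfolding open_edit_measure_def by blast
  then show thesis
    unfolding edit_costs_def using that by blast
qed

lemma open_edit_measure_nonneg:
  assumes "open_edit_measure A L \<alpha> \<beta> \<gamma> \<delta> m" "w \<in> lists A"
  shows "0 \<le> m w"
proof -
  have "0 \<le> \<alpha>" "0 \<le> \<beta>" "0 \<le> \<gamma>" "0 \<le> \<delta>"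
    using assms(1) by (auto simp: open_edit_measure_def)
  moreover obtain ns ni nd nt v where "edits A w ns ni nd nt v" "v \<in> prefix_closure L"
    "m w = \<alpha> * real ns + \<beta> * real ni + \<gamma> * real nd + \<delta> * real nt"
    by (rule open_edit_measure_attained[OF assms])
  ultimately show ?thesis by simp
qed

theorem theorem4:
  "\<exists>(A :: nat set) L \<alpha> \<beta> \<gamma> \<delta> m ms.
     finite A \<and> L \<subseteq> lists A \<and>
     open_edit_measure A L \<alpha> \<beta> \<gamma> \<delta> m \<and>
     tightest_contractible_approximation A m ms \<and>
     \<not> (\<exists>L' \<alpha>' \<beta>' \<gamma>' \<delta>' m'.
          L' \<subseteq> lists A \<and>
          open_edit_measure A L' \<alpha>' \<beta>' \<gamma>' \<delta>' m' \<and>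
          proper A L' m' \<and>
          (\<forall>w \<in> lists A. m' w = ms w))"
proof -
  \<comment> \<open>The letters a and b are 0 and 1.\<close>
  define A :: "nat set" where "A = {0, 1}"
  define L :: "nat list set" where "L = {[0, 1, 1]}"
  \<comment> \<open>\<open>Suc 0\<close> is included because the simplifier rewrites the natural
    number 1 to it.\<close>
  have A [simp]: "0 \<in> A" "1 \<in> A" "Suc 0 \<in> A" and finite: "finite A"
    by (auto simp: A_def)
  have L: "L \<subseteq> lists A" by (simp add: L_def)
  have pc: "prefix_closure L = {[], [0], [0, 1], [0, 1, 1]}"
    by (auto simp: prefix_closure_def L_def append_eq_Cons_conv)
  obtain m where m: "open_edit_measure A L 2 2 2 1 m"
    using open_edit_measure_exists[of L A 2 2 2 1] by (auto simp: L_def)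
  note m_nonneg = open_edit_measure_nonneg[OF m]
  define ms where "ms = (\<lambda>w. INF u\<in>lists A. m (w @ u))"
  have tight: "tightest_contractible_approximation A m ms"
    unfolding ms_def using m_nonneg by (rule INF_append_tightest)
  have ms_nonneg: "0 \<le> ms w" if "w \<in> lists A" for w
    using tight that
    by (auto simp: tightest_contractible_approximation_def contractible_approximation_def)
  have ms_le: "ms w \<le> m (w @ u)" if "w \<in> lists A" "u \<in> lists A" for w u
    unfolding ms_def using that m_nonneg by (intro cINF_lower bdd_belowI2[of _ 0]) auto
  have ms_ge: "c \<le> ms w" if "\<And>u. u \<in> lists A \<Longrightarrow> c \<le> m (w @ u)" for c w
    unfolding ms_def using that by (intro cINF_greatest) auto
  \<comment> \<open>A cost below 2 has room for at most one transposition and for nothing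
    else.\<close>
  have cheap: "w \<in> prefix_closure L \<and> m w = 0 \<or>
      m w = 1 \<and> (\<exists>x a b y. w = x @ a # b # y \<and> x @ b # a # y \<in> prefix_closure L)"
    if w: "w \<in> lists A" and "m w < 2" for w
  proof -
    obtain ns ni nd nt v where e: "edits A w ns ni nd nt v" "v \<in> prefix_closure L"
      and c: "m w = 2 * real ns + 2 * real ni + 2 * real nd + 1 * real nt"
      by (rule open_edit_measure_attained[OF m w])
    have "real (2 * ns + 2 * ni + 2 * nd + nt) < real 2"
      using that(2) c by simp
    then have "2 * ns + 2 * ni + 2 * nd + nt < 2"
      by (simp only: of_nat_less_iff)
    then have "ns = 0" "ni = 0" "nd = 0" "nt = 0 \<or> nt = 1" by auto
    from \<open>nt = 0 \<or> nt = 1\<close> show ?thesis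
    proof
      assume "nt = 0"
      then have "v = w"
        using e(1) \<open>ns = 0\<close> \<open>ni = 0\<close> \<open>nd = 0\<close> by (simp add: edits_none)
      then show ?thesis
        using e(2) c \<open>ns = 0\<close> \<open>ni = 0\<close> \<open>nd = 0\<close> \<open>nt = 0\<close> by simp
    next
      assume "nt = 1"
      then obtain x a b y where "w = x @ a # b # y" "v = x @ b # a # y"
        using e(1) edits_one_transp[of A w v] \<open>ns = 0\<close> \<open>ni = 0\<close> \<open>nd = 0\<close> by auto
      moreover have "m w = 1"
        using c \<open>ns = 0\<close> \<open>ni = 0\<close> \<open>nd = 0\<close> \<open>nt = 1\<close> by simp
      ultimately show ?thesis
        using e(2) by blast
    qed
  qed
  have zero: "ms w = 0" if "w \<in> prefix_closure L" for w
  proof -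
    have w: "w \<in> lists A" using that by (auto simp: pc)
    then have "ms w \<le> 0"
      using ms_le[OF w, of "[]"] open_edit_measure_le[OF m w edits.refl that] by simp
    with ms_nonneg[OF w] show ?thesis by simp
  qed
  \<comment> \<open>The extension ba is one transposition away from ab.\<close>
  have b_le: "ms [1] \<le> 1"
  proof -
    have "edits A [1, 0] 0 0 0 (Suc 0) ([] @ 0 # 1 # [])"
      by (rule edits.transp) (use edits.refl in simp)
    from open_edit_measure_le[OF m _ this] have "m [1, 0] \<le> 1"
      by (simp add: pc)
    with ms_le[of "[1]" "[0]"] show ?thesis by simp
  qed
  \<comment> \<open>No prefix of abb starts with b, so by \<open>cheap\<close> each extension of b
    costs 1 or at least 2.\<close>
  have b_ge: "1 \<le> ms [1]"
  proof (rule ms_ge)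
    fix u assume "u \<in> lists A"
    moreover have "1 # u \<notin> prefix_closure L" by (simp add: pc)
    ultimately show "1 \<le> m ([1] @ u)"
      using cheap[of "1 # u"] by (cases "m (1 # u) < 2") auto
  qed
  \<comment> \<open>Both cases of \<open>cheap\<close> give a word of the closure with the same
    letters as \<open>0 # 0 # u\<close>, but no prefix of abb contains two a's.\<close>
  have aa: "2 \<le> ms [0, 0]"
  proof (rule ms_ge, rule ccontr)
    fix u assume u: "u \<in> lists A" and "\<not> 2 \<le> m ([0, 0] @ u)"
    then consider "0 # 0 # u \<in> prefix_closure L"
      | x a b y where "0 # 0 # u = x @ a # b # y" "x @ b # a # y \<in> prefix_closure L"
      using cheap[of "0 # 0 # u"] by auto
    then obtain v where v: "mset v = mset (0 # 0 # u)" "v \<in> prefix_closure L"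
    proof cases
      case 2
      then show ?thesis using that[of "x @ b # a # y"] by simp
    qed blast
    from v(1) have "count (mset v) 0 \<ge> 2" by simp
    with v(2) show False by (auto simp: pc)
  qed
  have bb: "2 \<le> ms [1, 1]"
  proof (rule ms_ge, rule ccontr)
    fix u assume u: "u \<in> lists A" and "\<not> 2 \<le> m ([1, 1] @ u)"
    moreover have "1 # 1 # u \<notin> prefix_closure L" by (simp add: pc)
    ultimately obtain x a b y
      where "1 # 1 # u = x @ a # b # y" "x @ b # a # y \<in> prefix_closure L"
      using cheap[of "1 # 1 # u"] by auto
    \<comment> \<open>If \<open>x\<close> is empty, the two leading b's are swapped; otherwise
      \<open>x\<close> begins with b. Either way the result begins with b.\<close>
    then show False by (cases x) (simp_all add: pc)
  qed
  have no_proper: "False" if m': "open_edit_measure A L' \<alpha> \<beta> \<gamma> \<delta> m'" and pr: "proper A L' m'"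
    and eq: "\<forall>w\<in>lists A. m' w = ms w" for L' \<alpha> \<beta> \<gamma> \<delta> m'
  proof -
    have pos: "0 \<le> \<alpha>" "0 \<le> \<beta>" "0 \<le> \<gamma>" "0 \<le> \<delta>"
      using m' by (auto simp: open_edit_measure_def)
    \<comment> \<open>Properness fixes the prefix closure of \<open>L'\<close> on words over
      \<open>A\<close> as the zero set of \<open>ms\<close>: it contains all prefixes of abb, but
      not b.\<close>
    have pc': "w \<in> prefix_closure L' \<longleftrightarrow> ms w = 0" if "w \<in> lists A" for w
      using pr eq that by (simp add: proper_def)
    have in_pc': "[0] \<in> prefix_closure L'" "[0, 1] \<in> prefix_closure L'" "[0, 1, 1] \<in> prefix_closure L'"
      by (auto simp: pc' zero pc)
    \<comment> \<open>Three single edits, aa to ab, aa to a and bb to abb, each end in the closure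
      and start where \<open>ms\<close> is at least 2, so each weight is at least 2.\<close>
    have "edits A [0, 0] (Suc 0) 0 0 0 ([0] @ 1 # [])"
      by (rule edits.subst[where a = 0]) (use edits.refl in simp_all)
    from open_edit_measure_le[OF m' _ this] have \<alpha>: "2 \<le> \<alpha>"
      using in_pc' aa eq by simp
    have "edits A [0, 0] 0 0 (Suc 0) 0 ([0] @ [])"
      by (rule edits.del[where a = 0]) (use edits.refl in simp)
    from open_edit_measure_le[OF m' _ this] have \<gamma>: "2 \<le> \<gamma>"
      using in_pc' aa eq by simp
    have "edits A [1, 1] 0 (Suc 0) 0 0 ([] @ 0 # [1, 1])"
      by (rule edits.ins) (use edits.refl in simp_all)
    from open_edit_measure_le[OF m' _ this] have \<beta>: "2 \<le> \<beta>"
      using in_pc' bb eq by simp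
    have "[1] \<in> lists A" by simp
    then obtain ns ni nd nt v
      where e: "edits A [1] ns ni nd nt v" "v \<in> prefix_closure L'"
        and c: "m' [1] = \<alpha> * real ns + \<beta> * real ni + \<gamma> * real nd + \<delta> * real nt"
      by (rule open_edit_measure_attained[OF m'])
    \<comment> \<open>These bounds replace the products of unknown weights and counts by terms
      linear in the counts.\<close>
    have le: "2 * real ns \<le> \<alpha> * real ns" "2 * real ni \<le> \<beta> * real ni" "2 * real nd \<le> \<gamma> * real nd"
      "0 \<le> \<delta> * real nt"
      using \<alpha> \<beta> \<gamma> pos by (auto intro: mult_right_mono)
    have "m' [1] \<le> 1"
      using b_le eq by simp
    then have "real (2 * (ns + ni + nd)) < real 2"
      using c le by simp
    then have "ns = 0" "ni = 0" "nd = 0"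
      by (simp_all only: of_nat_less_iff) auto
    \<comment> \<open>No positive lower bound on \<open>\<delta>\<close> is available, so
      \<open>nt\<close> may be arbitrary; the multiset still determines a one-letter word.\<close>
    with e(1) have "mset v = mset [1]"
      by (simp add: edits_transp_only_mset)
    then have "v = [1]" by simp
    with e(2) have "ms [1] = 0" by (simp add: pc')
    with b_ge show False by simp
  qed
  show ?thesis
    by (intro exI[of _ A] exI[of _ L] exI[of _ 2] exI[of _ 1] exI[of _ m] exI[of _ ms]
        conjI notI finite L m tight; elim exE conjE; rule no_proper)
qed

end
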